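(* Let $\mathcal X$ be a Banach space, $\mathfrak B\subset\mathcal X$, let $\mathcal Y$ and $\mathcal Y^{\rm obs}$ be sets, $F:\mathfrak B\to\mathcal Y$, $u^\dagger\in\mathfrak B$, $g^\dagger:=F(u^\dagger)$, and $g^{\rm obs}\in\mathcal Y^{\rm obs}$. For $g\in F(\mathfrak B)$ let $\mathcal T(g^\dagger;g)\in[0,\infty]$ and $\mathcal S(g^{\rm obs};g)\in[0,\infty]$ be given, with $\mathcal T(g^\dagger;g^\dagger)=0$, and suppose there are constants $\mathbf{err}\ge 0$ and $C_{\rm err}\ge1$ such that $$\mathcal S(g^{\rm obs};g)-\mathcal S(g^{\rm obs};g^\dagger)\ \ge\ \frac1{C_{\rm err}}\mathcal T(g^\dagger;g)-\mathbf{err}\qquad\text{for all } g\in F(\mathfrak B).$$ Let $\mathcal R:\mathcal X\to(-\infty,\infty]$ be a proper convex functional, and suppose there exist $u^*\in\partial\mathcal R(u^\dagger)$, $\beta>0$ and an index function $\varphi$ such that $\varphi^2$ is concave and $$\beta\,\mathcal D_{\mathcal R}^{u^*}(u,u^\dagger)\ \le\ \mathcal R(u)-\mathcal R(u^\dagger)+\varphi\left(\mathcal T(g^\dagger;F(u))\right)\qquad\text{for all }u\in\mathfrak B.$$ Suppose that for $\alpha>0$ the Tikhonov functional $u\mapsto \mathcal S(g^{\rm obs};F(u))+\alpha\mathcal R(u)$ has a global minimizer over $\mathfrak B$, and let $u_\alpha$ denote any such minimizer. Then: (1) For all $\alpha>0$ and $\mathbf{err}\ge0$, $$\beta\,\mathcal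 D_{\mathcal R}^{u^*}(u_\alpha,u^\dagger)\ \le\ \frac{\mathbf{err}}{\alpha}+(-\varphi)^*\left(-\frac1{C_{\rm err}\,\alpha}\right).$$ (2) Let $\mathbf{err}>0$. Then the infimum over $\alpha>0$ of the right-hand side of the inequality in (1) is attained at $\alpha=\overline\alpha$ if and only if $\frac{-1}{C_{\rm err}\overline\alpha}\in\partial(-\varphi)(C_{\rm err}\,\mathbf{err})$, and for such $\overline\alpha$ we have $$\beta\,\mathcal D_{\mathcal R}^{u^*}(u_{\overline\alpha},u^\dagger)\ \le\ \sqrt{C_{\rm err}}\;\varphi(\mathbf{err}).$$
   Context: The assumed inequality relating $\mathcal S$ and $\mathcal T$ is understood to include $\mathcal S(g^{\rm obs};g^\dagger)<\infty$, so that the left-hand side is well defined in $(-\infty,\infty]$. Subdifferential and Bregman distance: $u^*\in\partial\mathcal R(u^\dagger)\subset\mathcal X^*$ means $\mathcal R(u^\dagger)<\infty$ and $\mathcal R(u)\ge\mathcal R(u^\dagger)+\langle u^*,u-u^\dagger\rangle$ for all $u\in\mathcal X$, and $\mathcal D_{\mathcal R}^{u^*}(u,u^\dagger):=\mathcal R(u)-\mathcal R(u^\dagger)-\langle u^*,u-u^\dagger\rangle$. An index function is a (finite) monotonically increasing function $\varphi:[0,\infty)\to[0,\infty)$ with $\varphi(0)=0$; one puts $\varphi(\infty):=\lim_{\tau\to\infty}\varphi(\tau)$. Set $\varphi(\tau):=-\infty$ for $\tau<0$, so that $-\varphi:\mathbb R\to(-\infty,\infty]$ is convex. The Fenchel conjugate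 of $\phi:\mathbb R\to(-\infty,\infty]$ is $\phi^*(s)=\sup_{\tau\in\mathbb R}(s\tau-\phi(\tau))$; hence $(-\varphi)^*(s)=\sup_{\tau\ge0}(s\tau+\varphi(\tau))$. $\partial(-\varphi)$ denotes the convex subdifferential of $-\varphi$. *)

theory Defs
  imports "HOL-Analysis.Analysis"
begin

text \<open>Functionals with values in \<open>(-\<infinity>, \<infinity>]\<close> are rendered as \<open>ereal\<close>-valued functions that omit
  \<open>-\<infinity>\<close>. Since \<open>0 * \<infinity> = 0\<close> in \<open>ereal\<close>, the end points \<open>t = 0\<close> and \<open>t = 1\<close> of the convexity
  inequality are vacuous.\<close>

definition proper_convex :: "('a::real_vector \<Rightarrow> ereal) \<Rightarrow> bool" where
  "proper_convex R \<longleftrightarrow>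
     (\<forall>u. R u \<noteq> -\<infinity>) \<and> (\<exists>u. R u \<noteq> \<infinity>) \<and>
     (\<forall>u v. \<forall>t\<in>{0..1::real}.
        R ((1 - t) *\<^sub>R u + t *\<^sub>R v) \<le> ereal (1 - t) * R u + ereal t * R v)"

definition subdifferential :: "('a::real_normed_vector \<Rightarrow> ereal) \<Rightarrow> 'a \<Rightarrow> ('a \<Rightarrow>\<^sub>L real) set" where
  "subdifferential R u0 =
     {l. R u0 < \<infinity> \<and> (\<forall>u. R u \<ge> R u0 + ereal (blinfun_apply l (u - u0)))}"

text \<open>The same notion on the real line, with slopes in place of functionals.\<close>

definition subdifferential_real :: "(real \<Rightarrow> ereal) \<Rightarrow> real \<Rightarrow> real set" where
  "subdifferential_real f t0 = {s. f t0 < \<infinity> \<and> (\<forall>t. f t \<ge> f t0 + ereal (s * (t - t0)))}"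

definition bregman_distance ::
    "('a::real_normed_vector \<Rightarrow> ereal) \<Rightarrow> ('a \<Rightarrow>\<^sub>L real) \<Rightarrow> 'a \<Rightarrow> 'a \<Rightarrow> ereal" where
  "bregman_distance R l u u0 = R u - R u0 - ereal (blinfun_apply l (u - u0))"

definition fenchel_conjugate :: "(real \<Rightarrow> ereal) \<Rightarrow> real \<Rightarrow> ereal" where
  "fenchel_conjugate f s = (SUP t. ereal (s * t) - f t)"

text \<open>An index function lives on \<open>[0, \<infinity>)\<close>; its values at negative arguments are irrelevant.
  Monotonicity is weak.\<close>

definition index_function :: "(real \<Rightarrow> real) \<Rightarrow> bool" where
  "index_function \<phi> \<longleftrightarrow> mono_on {0..} \<phi> \<and> (\<forall>t\<ge>0. 0 \<le> \<phi> t) \<and> \<phi> 0 = 0"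

text \<open>Extension by \<open>-\<infinity>\<close> to negative arguments and by the (possibly infinite) limit to \<open>\<infinity>\<close>.\<close>

definition index_ext :: "(real \<Rightarrow> real) \<Rightarrow> ereal \<Rightarrow> ereal" where
  "index_ext \<phi> t =
     (if t < 0 then -\<infinity>
      else if t = \<infinity> then Lim at_top (\<lambda>r::real. ereal (\<phi> r))
      else ereal (\<phi> (real_of_ereal t)))"

definition neg_index :: "(real \<Rightarrow> real) \<Rightarrow> real \<Rightarrow> ereal" where
  "neg_index \<phi> t = - index_ext \<phi> (ereal t)"

definition tikhonov ::
    "('z \<Rightarrow> 'y \<Rightarrow> ereal) \<Rightarrow> ('a \<Rightarrow> 'y) \<Rightarrow> ('a \<Rightarrow> ereal) \<Rightarrow> 'z \<Rightarrow> real \<Rightarrow> 'a \<Rightarrow> ereal" where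
  "tikhonov S F R gobs \<alpha> u = S gobs (F u) + ereal \<alpha> * R u"

end

theory Submission
  imports Defs
begin

text \<open>Comparing \<open>u\<^sub>\<alpha>\<close> with \<open>u\<^sup>\<dagger>\<close> in the Tikhonov functional and inserting the noise bound turns the
  variational inequality into a bound by \<open>err / \<alpha> - t / (C\<^sub>e\<^sub>r\<^sub>r \<alpha>) + \<phi> t\<close> at \<open>t = T (g\<^sup>\<dagger>; F u\<^sub>\<alpha>)\<close>; the
  conjugate is the supremum of this over \<open>t\<close>. With \<open>s = -1 / (C\<^sub>e\<^sub>r\<^sub>r \<alpha>)\<close> and \<open>x = C\<^sub>e\<^sub>r\<^sub>r err\<close> the bound is
  \<open>(-\<phi>)\<^sup>*(s) - s x \<ge> \<phi> x\<close>, with equality exactly when \<open>s\<close> is a subgradient of \<open>-\<phi>\<close> at \<open>x\<close>. Its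
  infimum over \<open>s < 0\<close> is \<open>\<phi> x\<close> even if \<open>0\<close> is the only subgradient, because tilting a subgradient
  slightly costs arbitrarily little. Finally \<open>\<phi> x \<le> sqrt C\<^sub>e\<^sub>r\<^sub>r * \<phi> err\<close> by concavity of \<open>\<phi>\<^sup>2\<close>.\<close>

lemma neg_index_nonneg: "0 \<le> t \<Longrightarrow> neg_index \<phi> t = ereal (- \<phi> t)"
  by (simp add: neg_index_def index_ext_def)

lemma neg_index_neg: "t < 0 \<Longrightarrow> neg_index \<phi> t = \<infinity>"
  by (simp add: neg_index_def index_ext_def)

lemma fenchel_conjugate_neg_index_ge:
  assumes "0 \<le> t"
  shows "ereal (s * t + \<phi> t) \<le> fenchel_conjugate (neg_index \<phi>) s"
proof -
  have "ereal (s * t) - neg_index \<phi> t \<le> fenchel_conjugate (neg_index \<phi>) s"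
    unfolding fenchel_conjugate_def by (rule SUP_upper) simp
  then show ?thesis by (simp add: neg_index_nonneg assms)
qed

lemma fenchel_conjugate_neg_index_le:
  assumes "\<And>t. 0 \<le> t \<Longrightarrow> s * t + \<phi> t \<le> b"
  shows "fenchel_conjugate (neg_index \<phi>) s \<le> ereal b"
  unfolding fenchel_conjugate_def
proof (rule SUP_least)
  fix t
  show "ereal (s * t) - neg_index \<phi> t \<le> ereal b"
    using assms[of t] by (cases "t < 0") (simp_all add: neg_index_neg neg_index_nonneg)
qed

text \<open>The conjugate can be infinite, so it is compared with a real bound pointwise in
  \<open>t\<close>; negative \<open>t\<close> contribute only \<open>-\<infinity>\<close> to the
  supremum. Later estimates thereby become inequalities between reals.\<close>

lemma fenchel_conjugate_neg_index_le_iff: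
  "ereal a + fenchel_conjugate (neg_index \<phi>) s \<le> ereal b \<longleftrightarrow> (\<forall>t\<ge>0. a + s * t + \<phi> t \<le> b)"
proof
  assume le: "ereal a + fenchel_conjugate (neg_index \<phi>) s \<le> ereal b"
  show "\<forall>t\<ge>0. a + s * t + \<phi> t \<le> b"
  proof (intro allI impI)
    fix t :: real assume "0 \<le> t"
    then have "ereal a + ereal (s * t + \<phi> t) \<le> ereal a + fenchel_conjugate (neg_index \<phi>) s"
      by (intro add_left_mono fenchel_conjugate_neg_index_ge)
    then have "ereal (a + (s * t + \<phi> t)) \<le> ereal b"
      using le unfolding plus_ereal.simps by (rule order_trans)
    then show "a + s * t + \<phi> t \<le> b" by (simp add: add.assoc)
  qed
next
  assume "\<forall>t\<ge>0. a + s * t + \<phi> t \<le> b"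
  then have "fenchel_conjugate (neg_index \<phi>) s \<le> ereal (b - a)"
    by (intro fenchel_conjugate_neg_index_le) (auto simp: algebra_simps)
  then have "ereal a + fenchel_conjugate (neg_index \<phi>) s \<le> ereal a + ereal (b - a)"
    by (rule add_left_mono)
  then show "ereal a + fenchel_conjugate (neg_index \<phi>) s \<le> ereal b" by simp
qed

text \<open>Fenchel-Young inequality, from the term \<open>t = x\<close> of the supremum. The
  summand \<open>- s * x\<close> is kept next to the conjugate because it becomes
  \<open>err / \<alpha>\<close> in the error bound.\<close>

lemma fenchel_young_neg_index:
  assumes "0 \<le> x"
  shows "ereal (\<phi> x) \<le> ereal (- s * x) + fenchel_conjugate (neg_index \<phi>) s"
proof -
  have "ereal (- s * x) + ereal (s * x + \<phi> x) \<le> ereal (- s * x) + fenchel_conjugate (neg_index \<phi>) s"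
    by (intro add_left_mono fenchel_conjugate_neg_index_ge assms)
  then show ?thesis by simp
qed

text \<open>Equality case of Fenchel-Young: taking the supremum over \<open>t\<close> in the
  rearranged subgradient inequality gives \<open>\<le>\<close>, and Fenchel-Young gives the
  reverse.\<close>

lemma subdifferential_neg_index_iff:
  assumes "0 \<le> x"
  shows "s \<in> subdifferential_real (neg_index \<phi>) x \<longleftrightarrow>
    ereal (- s * x) + fenchel_conjugate (neg_index \<phi>) s = ereal (\<phi> x)"
proof -
  have "neg_index \<phi> t \<ge> neg_index \<phi> x + ereal (s * (t - x)) \<longleftrightarrow>
      (0 \<le> t \<longrightarrow> - s * x + s * t + \<phi> t \<le> \<phi> x)" for t
    by (cases "t < 0") (auto simp: neg_index_neg neg_index_nonneg assms algebra_simps)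
  then have "s \<in> subdifferential_real (neg_index \<phi>) x \<longleftrightarrow>
      ereal (- s * x) + fenchel_conjugate (neg_index \<phi>) s \<le> ereal (\<phi> x)"
    unfolding fenchel_conjugate_neg_index_le_iff
    by (simp add: subdifferential_real_def neg_index_nonneg assms)
  then show ?thesis
    using fenchel_young_neg_index[OF assms, of \<phi> s] by (auto intro: antisym)
qed

text \<open>By convexity of the square, the squared mean of two values is at most the mean of their
  squares, which concavity of the square of \<open>\<phi>\<close> bounds; nonnegativity then allows
  taking roots.\<close>

lemma concave_on_of_power2:
  fixes \<phi> :: "'a::real_vector \<Rightarrow> real"
  assumes "concave_on A (\<lambda>t. (\<phi> t)\<^sup>2)" and "\<And>t. t \<in> A \<Longrightarrow> 0 \<le> \<phi> t"
  shows "concave_on A \<phi>"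
  unfolding concave_on_iff
proof (intro conjI ballI allI impI)
  show "convex A" using assms(1) by (simp add: concave_on_iff)
next
  fix x y and u v :: real
  assume xy: "x \<in> A" "y \<in> A" and uv: "0 \<le> u" "0 \<le> v" "u + v = 1"
  have mem: "u *\<^sub>R x + v *\<^sub>R y \<in> A"
    using assms(1) xy uv by (auto simp: concave_on_iff convex_def)
  have u: "u = 1 - v" using uv by simp
  have "(u * \<phi> x + v * \<phi> y)\<^sup>2 \<le> u * (\<phi> x)\<^sup>2 + v * (\<phi> y)\<^sup>2"
    using convex_onD[OF convex_power2, of v "\<phi> x" "\<phi> y"] uv
    by (simp add: u)
  also have "\<dots> \<le> (\<phi> (u *\<^sub>R x + v *\<^sub>R y))\<^sup>2"
    using assms(1) xy uv by (simp add: concave_on_iff)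
  finally show "u * \<phi> x + v * \<phi> y \<le> \<phi> (u *\<^sub>R x + v *\<^sub>R y)"
    using assms(2)[OF mem] by (rule power2_le_imp_le)
qed

lemma concave_on_supergradient:
  fixes f :: "real \<Rightarrow> real"
  assumes "concave_on A f" and "x \<in> interior A"
  obtains m where "\<And>y. y \<in> A \<Longrightarrow> f y \<le> f x + m * (y - x)"
proof -
  have "convex_on A (\<lambda>t. - f t)" using assms(1) by (simp add: concave_on_def)
  note le = convex_le_Inf_differential[OF this assms(2)]
  show thesis
    \<comment> \<open>The infimum of difference quotients is the right derivative of
      \<open>- f\<close> at \<open>x\<close>, so the slope chosen is the right derivative of
      \<open>f\<close>.\<close>
    by (rule that[of "- Inf ((\<lambda>t. (- f x - - f t) / (x - t)) ` ({x<..} \<inter> A))"])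
      (use le in force)
qed

text \<open>Concavity is applied to the square, which gains the factor \<open>c\<close>; its root is
  \<open>sqrt c\<close>, where concavity of \<open>\<phi>\<close> alone would give only
  \<open>c\<close>.\<close>

lemma index_function_le_sqrt:
  assumes "index_function \<phi>" and "concave_on {0..} (\<lambda>t. (\<phi> t)\<^sup>2)" and "1 \<le> c" and "0 \<le> x"
  shows "\<phi> (c * x) \<le> sqrt c * \<phi> x"
proof -
  have z: "\<phi> 0 = 0" and nn: "0 \<le> \<phi> x" using assms by (auto simp: index_function_def)
  \<comment> \<open>The point \<open>x\<close> lies between \<open>0\<close> and
    \<open>c * x\<close>, with weight \<open>1 / c\<close> on the latter.\<close>
  have "(1 - 1 / c) * (\<phi> 0)\<^sup>2 + (1 / c) * (\<phi> (c * x))\<^sup>2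
      \<le> (\<phi> ((1 - 1 / c) *\<^sub>R 0 + (1 / c) *\<^sub>R (c * x)))\<^sup>2"
    using assms by (intro concave_onD[OF assms(2)]) auto
  then have "(\<phi> (c * x))\<^sup>2 \<le> c * (\<phi> x)\<^sup>2"
    using assms(3) z by (simp add: field_simps)
  then have "(\<phi> (c * x))\<^sup>2 \<le> (sqrt c * \<phi> x)\<^sup>2"
    using assms(3) by (simp add: power_mult_distrib)
  then show ?thesis
    by (rule power2_le_imp_le) (use nn assms(3) in auto)
qed

text \<open>The infimum need not be attained: if \<open>\<phi>\<close> is constant near
  \<open>c * e\<close>, the only supergradient there is \<open>0\<close>, which no finite
  \<open>\<alpha>\<close> realizes. Hence the upper bound is proved up to
  \<open>\<epsilon>\<close>.\<close>

lemma INF_fenchel_conjugate_neg_index: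
  assumes \<phi>: "index_function \<phi>" and conc: "concave_on {0..} \<phi>" and c: "0 < c" and e: "0 < e"
  shows "(INF \<alpha>\<in>{0<..}. ereal (e / \<alpha>) + fenchel_conjugate (neg_index \<phi>) (- 1 / (c * \<alpha>)))
    = ereal (\<phi> (c * e))"
    (is "(INF \<alpha>\<in>_. ?h \<alpha>) = _")
proof (rule antisym)
  define x where "x = c * e"
  have x: "0 < x" using c e by (simp add: x_def)
  then have "x \<in> interior {0..}" by simp
  then obtain m where m: "\<And>y. y \<in> {0..} \<Longrightarrow> \<phi> y \<le> \<phi> x + m * (y - x)"
    using concave_on_supergradient[OF conc] by blast
  \<comment> \<open>Monotonicity makes the supergradient \<open>m\<close> nonnegative, so the tilted
    slope \<open>k\<close> below is positive.\<close>
  have "\<phi> x \<le> \<phi> (x + 1)"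
    using \<phi> x by (auto simp: index_function_def mono_on_def)
  with m[of "x + 1"] x have m0: "0 \<le> m" by simp
  have "(INF \<alpha>\<in>{0<..}. ?h \<alpha>) \<le> ereal (\<phi> x) + ereal \<epsilon>" if \<epsilon>: "0 < \<epsilon>" for \<epsilon>
  proof -
    \<comment> \<open>The tilt \<open>\<epsilon> / x\<close> adds
      \<open>(\<epsilon> / x) * (x - t)\<close>, which is at most \<open>\<epsilon>\<close> for
      \<open>t \<ge> 0\<close>.\<close>
    define k where "k = m + \<epsilon> / x"
    have k: "0 < k" using m0 \<epsilon> x by (simp add: k_def add_nonneg_pos)
    have "k * x + - k * t + \<phi> t \<le> \<phi> x + \<epsilon>" if t: "0 \<le> t" for t
    proof -
      have "k * (x - t) = m * (x - t) + \<epsilon> - \<epsilon> * t / x"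
        using x by (simp add: k_def field_simps)
      moreover have "0 \<le> \<epsilon> * t / x" using \<epsilon> x t by simp
      ultimately show ?thesis using m[of t] t by (simp add: algebra_simps)
    qed
    then have "ereal (k * x) + fenchel_conjugate (neg_index \<phi>) (- k) \<le> ereal (\<phi> x + \<epsilon>)"
      unfolding fenchel_conjugate_neg_index_le_iff by blast
    \<comment> \<open>The parameter \<open>1 / (c * k)\<close> is the \<open>\<alpha>\<close> for
      which \<open>- 1 / (c * \<alpha>)\<close> is the slope \<open>- k\<close>.\<close>
    moreover have "e / (1 / (c * k)) = k * x" and "- 1 / (c * (1 / (c * k))) = - k"
      using c k by (simp_all add: x_def)
    ultimately have "?h (1 / (c * k)) \<le> ereal (\<phi> x) + ereal \<epsilon>"
      by (simp only: plus_ereal.simps)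
    then show ?thesis
      by (rule INF_lower2[rotated]) (use c k in simp)
  qed
  then show "(INF \<alpha>\<in>{0<..}. ?h \<alpha>) \<le> ereal (\<phi> (c * e))"
    unfolding x_def[symmetric] by (rule ereal_le_epsilon2) blast
next
  show "ereal (\<phi> (c * e)) \<le> (INF \<alpha>\<in>{0<..}. ?h \<alpha>)"
  proof (rule INF_greatest)
    fix \<alpha> :: real assume "\<alpha> \<in> {0<..}"
    then show "ereal (\<phi> (c * e)) \<le> ?h \<alpha>"
      using fenchel_young_neg_index[of "c * e" \<phi> "- 1 / (c * \<alpha>)"] c e by simp
  qed
qed

lemma tikhonov_minimizer_bound:
  fixes R :: "'a::real_normed_vector \<Rightarrow> ereal"
  assumes u_dag: "u_dag \<in> B"
    and T_nonneg: "\<And>g. g \<in> F ` B \<Longrightarrow> 0 \<le> T (F u_dag) g"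
    and S_nonneg: "\<And>g. g \<in> F ` B \<Longrightarrow> 0 \<le> S g_obs g"
    and C: "0 < C"
    and S_finite: "S g_obs (F u_dag) < \<infinity>"
    and noise: "\<And>g. g \<in> F ` B \<Longrightarrow>
        S g_obs g - S g_obs (F u_dag) \<ge> ereal (1 / C) * T (F u_dag) g - ereal err"
    and R: "\<And>u. R u \<noteq> -\<infinity>" "R u_dag < \<infinity>"
    and variational: "\<And>u. u \<in> B \<Longrightarrow>
        ereal \<beta> * bregman_distance R u_star u u_dag
          \<le> R u - R u_dag + index_ext \<phi> (T (F u_dag) (F u))"
    and \<alpha>: "0 < \<alpha>"
    and min: "is_arg_min (tikhonov S F R g_obs \<alpha>) (\<lambda>u. u \<in> B) u"
  shows "ereal \<beta> * bregman_distance R u_star u u_dag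
    \<le> ereal (err / \<alpha>) + fenchel_conjugate (neg_index \<phi>) (- 1 / (C * \<alpha>))"
proof -
  have u: "u \<in> B" and le: "tikhonov S F R g_obs \<alpha> u \<le> tikhonov S F R g_obs \<alpha> u_dag"
    using min u_dag by (auto simp: is_arg_min_def not_less)
  obtain s0 where s0: "S g_obs (F u_dag) = ereal s0"
    using S_finite S_nonneg[of "F u_dag"] u_dag by (cases "S g_obs (F u_dag)") auto
  obtain r0 where r0: "R u_dag = ereal r0"
    using R(1)[of u_dag] R(2) by (cases "R u_dag") auto
  have fin: "S g_obs (F u) + ereal \<alpha> * R u \<le> ereal (s0 + \<alpha> * r0)"
    using le by (simp add: tikhonov_def s0 r0)
  \<comment> \<open>Neither summand can be \<open>-\<infinity>\<close>, so the finite bound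
    \<open>fin\<close> forces both to be finite, and the rest is real arithmetic.\<close>
  obtain s where s: "S g_obs (F u) = ereal s"
    using fin S_nonneg[of "F u"] u R(1)[of u] \<alpha>
    by (cases "S g_obs (F u)"; cases "R u") auto
  obtain r where r: "R u = ereal r"
    using fin s R(1)[of u] \<alpha> by (cases "R u") auto
  have sr: "s + \<alpha> * r \<le> s0 + \<alpha> * r0" using fin by (simp add: s r)
  have noise': "ereal (1 / C) * T (F u_dag) (F u) - ereal err \<le> ereal (s - s0)"
    using noise[of "F u"] u by (simp add: s s0)
  \<comment> \<open>An infinite \<open>T\<close> would make the left-hand side of
    \<open>noise'\<close> infinite, against the real right-hand side.\<close>
  then obtain t where t: "T (F u_dag) (F u) = ereal t"
    using T_nonneg[of "F u"] u C by (cases "T (F u_dag) (F u)") auto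
  have t0: "0 \<le> t" using T_nonneg[of "F u"] u t by simp
  have "t / C - err \<le> s - s0" using noise' by (simp add: t)
  with sr have "\<alpha> * (r - r0) \<le> err - t / C" by (simp add: algebra_simps)
  then have "r - r0 \<le> (err - t / C) / \<alpha>" using \<alpha> by (simp add: pos_le_divide_eq mult.commute)
  \<comment> \<open>The coefficient of \<open>t\<close> is the slope at which the conjugate is
    evaluated.\<close>
  also have "\<dots> = err / \<alpha> + - 1 / (C * \<alpha>) * t" by (simp add: diff_divide_distrib)
  finally have rr: "r - r0 + \<phi> t \<le> err / \<alpha> + (- 1 / (C * \<alpha>) * t + \<phi> t)" by simp
  have "ereal \<beta> * bregman_distance R u_star u u_dag \<le> ereal (r - r0 + \<phi> t)"
    using variational[OF u] t0 by (simp add: r r0 t index_ext_def)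
  also have "\<dots> \<le> ereal (err / \<alpha>) + ereal (- 1 / (C * \<alpha>) * t + \<phi> t)"
    using rr by simp
  also have "\<dots> \<le> ereal (err / \<alpha>) + fenchel_conjugate (neg_index \<phi>) (- 1 / (C * \<alpha>))"
    by (intro add_left_mono fenchel_conjugate_neg_index_ge t0)
  finally show ?thesis .
qed

theorem theorem3p3:
  fixes B :: "'a::banach set"
    and F :: "'a \<Rightarrow> 'y"
    and u_dag :: 'a and g_dag :: 'y and g_obs :: 'z
    and T :: "'y \<Rightarrow> 'y \<Rightarrow> ereal"
    and S :: "'z \<Rightarrow> 'y \<Rightarrow> ereal"
    and err C_err \<beta> :: real
    and R :: "'a \<Rightarrow> ereal"
    and u_star :: "'a \<Rightarrow>\<^sub>L real"
    and \<phi> :: "real \<Rightarrow> real"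
  assumes u_dag: "u_dag \<in> B"
    and g_dag: "g_dag = F u_dag"
    and T_nonneg: "\<And>g. g \<in> F ` B \<Longrightarrow> 0 \<le> T g_dag g"
    and S_nonneg: "\<And>g. g \<in> F ` B \<Longrightarrow> 0 \<le> S g_obs g"
    and T_zero: "T g_dag g_dag = 0"
    and err: "err \<ge> 0"
    and C_err: "C_err \<ge> 1"
    and S_finite: "S g_obs g_dag < \<infinity>"
    and noise: "\<And>g. g \<in> F ` B \<Longrightarrow>
        S g_obs g - S g_obs g_dag \<ge> ereal (1 / C_err) * T g_dag g - ereal err"
    and R: "proper_convex R"
    and u_star: "u_star \<in> subdifferential R u_dag"
    and \<beta>: "\<beta> > 0"
    and \<phi>: "index_function \<phi>"
    and \<phi>_sq: "concave_on {0..} (\<lambda>t. (\<phi> t)\<^sup>2)"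
    and variational: "\<And>u. u \<in> B \<Longrightarrow>
        ereal \<beta> * bregman_distance R u_star u u_dag
          \<le> R u - R u_dag + index_ext \<phi> (T g_dag (F u))"
    and minimizer_ex: "\<And>\<alpha>. \<alpha> > 0 \<Longrightarrow> \<exists>u. is_arg_min (tikhonov S F R g_obs \<alpha>) (\<lambda>u. u \<in> B) u"
  shows "(\<forall>\<alpha>>0. \<forall>u_\<alpha>. is_arg_min (tikhonov S F R g_obs \<alpha>) (\<lambda>u. u \<in> B) u_\<alpha> \<longrightarrow>
            ereal \<beta> * bregman_distance R u_star u_\<alpha> u_dag
              \<le> ereal (err / \<alpha>) + fenchel_conjugate (neg_index \<phi>) (- 1 / (C_err * \<alpha>)))
       \<and> (err > 0 \<longrightarrow>
            (\<forall>\<alpha>'>0.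
               (ereal (err / \<alpha>') + fenchel_conjugate (neg_index \<phi>) (- 1 / (C_err * \<alpha>'))
                  = (INF \<alpha>\<in>{0<..}. ereal (err / \<alpha>)
                       + fenchel_conjugate (neg_index \<phi>) (- 1 / (C_err * \<alpha>)))
                \<longleftrightarrow> - 1 / (C_err * \<alpha>') \<in> subdifferential_real (neg_index \<phi>) (C_err * err))
             \<and> (- 1 / (C_err * \<alpha>') \<in> subdifferential_real (neg_index \<phi>) (C_err * err) \<longrightarrow>
                  (\<forall>u_\<alpha>. is_arg_min (tikhonov S F R g_obs \<alpha>') (\<lambda>u. u \<in> B) u_\<alpha> \<longrightarrow>
                     ereal \<beta> * bregman_distance R u_star u_\<alpha> u_dag
                       \<le> ereal (sqrt C_err * \<phi> err)))))"
proof (intro conjI allI impI)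
  let ?h = "\<lambda>\<alpha>. ereal (err / \<alpha>) + fenchel_conjugate (neg_index \<phi>) (- 1 / (C_err * \<alpha>))"
  have C: "0 < C_err" using C_err by simp
  show bound: "ereal \<beta> * bregman_distance R u_star u u_dag \<le> ?h \<alpha>"
    if "0 < \<alpha>" "is_arg_min (tikhonov S F R g_obs \<alpha>) (\<lambda>u. u \<in> B) u" for \<alpha> u
  proof (rule tikhonov_minimizer_bound[where F = F and T = T and S = S, OF u_dag
        T_nonneg[unfolded g_dag] S_nonneg C S_finite[unfolded g_dag] noise[unfolded g_dag] _ _ variational[unfolded g_dag] that])
    show "R u_dag < \<infinity>" using u_star by (simp add: subdifferential_def)
    show "R u \<noteq> -\<infinity>" for u using R by (simp add: proper_convex_def)
  qed
  fix \<alpha>' :: real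
  assume e: "0 < err" and \<alpha>': "0 < \<alpha>'"
  have "concave_on {0..} \<phi>"
    by (rule concave_on_of_power2[OF \<phi>_sq]) (use \<phi> in \<open>auto simp: index_function_def\<close>)
  note Inf = INF_fenchel_conjugate_neg_index[OF \<phi> this C e]
  \<comment> \<open>With \<open>s = - 1 / (C_err * \<alpha>')\<close> and
    \<open>x = C_err * err\<close> one has \<open>- s * x = err / \<alpha>'\<close>, so the equality
    case of Fenchel-Young is a statement about \<open>?h \<alpha>'\<close>.\<close>
  have iff: "- 1 / (C_err * \<alpha>') \<in> subdifferential_real (neg_index \<phi>) (C_err * err) \<longleftrightarrow>
      ?h \<alpha>' = ereal (\<phi> (C_err * err))"
    using subdifferential_neg_index_iff[of "C_err * err" "- 1 / (C_err * \<alpha>')" \<phi>] C e by simp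
  show "?h \<alpha>' = (INF \<alpha>\<in>{0<..}. ?h \<alpha>) \<longleftrightarrow>
      - 1 / (C_err * \<alpha>') \<in> subdifferential_real (neg_index \<phi>) (C_err * err)"
    by (simp only: iff Inf)
  fix u
  assume "- 1 / (C_err * \<alpha>') \<in> subdifferential_real (neg_index \<phi>) (C_err * err)"
    and "is_arg_min (tikhonov S F R g_obs \<alpha>') (\<lambda>u. u \<in> B) u"
  then have "ereal \<beta> * bregman_distance R u_star u u_dag \<le> ereal (\<phi> (C_err * err))"
    using bound[OF \<alpha>', of u] unfolding iff by (simp only:)
  also have "\<dots> \<le> ereal (sqrt C_err * \<phi> err)"
    using index_function_le_sqrt[OF \<phi> \<phi>_sq C_err err] by simp
  finally show "ereal \<beta> * bregman_distance R u_star u u_dag \<le> ereal (sqrt C_err * \<phi> err)" .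
qed

end
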